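(* Let $m\ge 2$ and let $\gamma=\gamma_1\cdots\gamma_m\in\mathcal S_m(132)$ with $\gamma_1=m-1$ and $\gamma_m=m$. Let $B=B(t,x)=\sum_{n\ge 0}t^n\sum_{\sigma\in\mathcal S_n(132)}x^{\gamma\text{-mch}(\sigma)}$. Then $$B=\frac{1+t^{m-1}(x-1)(B^2-B)}{1-tB}.$$
   Context: $\mathcal S_n$ is the set of permutations of $\{1,\dots,n\}$ in one-line notation ($\mathcal S_0$ contains only the empty permutation, on which all statistics are $0$). For a word $w$ of distinct integers, $\mathrm{red}(w)$ replaces the $i$-th smallest letter by $i$. $\sigma\in\mathcal S_n$ avoids $\lambda\in\mathcal S_k$ (classical avoidance) if no (not necessarily contiguous) subsequence $\sigma_{i_1}\cdots\sigma_{i_k}$, $i_1<\dots<i_k$, has reduction $\lambda$; $\mathcal S_n(\lambda)$ is the set of such $\sigma$. $\gamma\text{-mch}(\sigma)$ is the number of $i$ with $\mathrm{red}(\sigma_i\sigma_{i+1}\cdots\sigma_{i+k-1})=\gamma$ for $\gamma\in\mathcal S_k$. The identity is one of formal power series in $t$ over $\mathbb Q[x]$. *)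

theory Defs
  imports
    "HOL-Combinatorics.Multiset_Permutations"
    "HOL-Library.Sublist"
    "HOL-Computational_Algebra.Polynomial"
    "HOL-Computational_Algebra.Formal_Power_Series"
begin

definition perms :: "nat \<Rightarrow> nat list set" where
  "perms n = permutations_of_set {1..n}"

text \<open>A letter of a word with distinct letters is its \<open>i\<close>-th smallest one iff exactly \<open>i\<close> letters
  are at most as large.\<close>

definition red :: "'a::linorder list \<Rightarrow> nat list" where
  "red w = map (\<lambda>a. card {b \<in> set w. b \<le> a}) w"

definition avoids :: "nat list \<Rightarrow> nat list \<Rightarrow> bool" where
  "avoids \<sigma> \<tau> \<longleftrightarrow> \<not> (\<exists>w. subseq w \<sigma> \<and> red w = \<tau>)"

definition avoiders :: "nat \<Rightarrow> nat list \<Rightarrow> nat list set" where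
  "avoiders n \<tau> = {\<sigma> \<in> perms n. avoids \<sigma> \<tau>}"

text \<open>Window positions are counted from \<open>0\<close>. The statistic is meant for nonempty \<open>\<gamma>\<close>; it then
  vanishes on the empty permutation.\<close>

definition mch :: "nat list \<Rightarrow> nat list \<Rightarrow> nat" where
  "mch \<gamma> \<sigma> = card {i. i + length \<gamma> \<le> length \<sigma> \<and> red (take (length \<gamma>) (drop i \<sigma>)) = \<gamma>}"

text \<open>Power series in \<open>t = fps_X\<close> over the rational polynomials in \<open>x = [:0, 1:]\<close>.\<close>

definition gf132 :: "nat list \<Rightarrow> rat poly fps" where
  "gf132 \<gamma> = Abs_fps (\<lambda>n. \<Sum>\<sigma> \<in> avoiders n [1, 3, 2]. [:0, 1:] ^ mch \<gamma> \<sigma>)"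

text \<open>The library's division of power series needs an inverse on the coefficients, which
  \<^typ>\<open>rat poly\<close> does not have. For a denominator with constant coefficient \<open>1\<close> the quotient
  exists over any commutative ring; \<open>fps_right_inverse g 1\<close> is then the inverse of \<open>g\<close>.\<close>

definition fps_quot :: "'a::comm_ring_1 fps \<Rightarrow> 'a fps \<Rightarrow> 'a fps" where
  "fps_quot f g = f * fps_right_inverse g 1"

lemma fps_quot_unique:
  assumes "fps_nth g 0 = 1"
  shows "h = fps_quot f g \<longleftrightarrow> h * g = f"
proof -
  have inv: "g * fps_right_inverse g 1 = 1"
    using fps_right_inverse[of g 1] assms by simp
  show ?thesis
  proof
    assume "h = fps_quot f g"
    then have "h * g = f * (g * fps_right_inverse g 1)"
      unfolding fps_quot_def by (simp only: ac_simps)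
    then show "h * g = f" by (simp only: inv mult_1_right)
  next
    assume "h * g = f"
    then have "fps_quot f g = h * (g * fps_right_inverse g 1)"
      unfolding fps_quot_def by (simp only: mult.assoc[symmetric])
    then show "h = fps_quot f g" by (simp only: inv mult_1_right)
  qed
qed

end

theory Submission
  imports Defs
begin

text \<open>A nonempty 132-avoiding permutation of size \<open>n\<close> is \<open>L n R\<close> with every letter of \<open>L\<close> above
  every letter of \<open>R\<close>. As \<open>\<gamma>\<close> ends with its maximum, a match of \<open>\<gamma>\<close> lies in \<open>L n\<close> or in \<open>R\<close>.
  A match ending at \<open>n\<close> means that \<open>L\<close> ends with a letter \<open>a\<close> followed by a word \<open>d\<close> order-isomorphic
  to \<open>D = \<gamma>\<^sub>2 \<dots> \<gamma>\<^bsub>m-1\<^esub>\<close>, all of whose letters are below \<open>a\<close>. Avoidance of 132 then puts the letters of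
  \<open>d\<close> below all others, so \<open>d = D\<close>, and removing \<open>D\<close> gives an arbitrary 132-avoider of size
  \<open>|L| - (m - 2) > 0\<close> with the same number of matches. Hence
  \<open>B = 1 + t (B + (x - 1) t\<^bsup>m-2\<^esup> (B - 1)) B\<close>.\<close>

section \<open>Reduction of words and ranks of letters\<close>

text \<open>The ranks in \<open>red\<close> depend only on the relative order of the letters. The
  lemma is applied to shifts of words and to relabellings of \<gamma>.\<close>

lemma red_map:
  fixes f :: "'a::linorder \<Rightarrow> 'b::linorder"
  assumes "strict_mono_on (set w) f"
  shows "red (map f w) = red w"
proof -
  have "card {b \<in> set (map f w). b \<le> f a} = card {b \<in> set w. b \<le> a}" if "a \<in> set w" for a
  proof -
    have "{b \<in> set (map f w). b \<le> f a} = f ` {b \<in> set w. b \<le> a}"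
      using strict_mono_on_less_eq[OF assms] that by auto
    moreover have "inj_on f {b \<in> set w. b \<le> a}"
      using strict_mono_on_imp_inj_on[OF assms] by (rule inj_on_subset) auto
    ultimately show ?thesis by (simp add: card_image)
  qed
  then show ?thesis by (simp add: red_def)
qed

lemma length_red [simp]: "length (red w) = length w"
  by (simp add: red_def)

lemma red_perm:
  assumes "w \<in> perms n"
  shows "red w = w"
proof -
  have "set w = {1..n}" using assms by (simp add: perms_def permutations_of_setD)
  then have "card {b \<in> set w. b \<le> a} = a" if "a \<in> set w" for a
  proof -
    have "{b \<in> set w. b \<le> a} = {1..a}" using \<open>set w = {1..n}\<close> that by auto
    then show ?thesis by simp
  qed
  then show ?thesis unfolding red_def by (intro map_idI) simp
qed

lemma length_perms: "w \<in> perms n \<Longrightarrow> length w = n"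
  by (simp add: perms_def length_finite_permutations_of_set)

lemma perms_iff: "w \<in> perms n \<longleftrightarrow> set w = {1..n} \<and> distinct w"
  by (auto simp: perms_def permutations_of_setD)

text \<open>Lets order relations between letters be read off an equation for \<open>red\<close>,
  whose entries are such cardinalities.\<close>

lemma card_le_less_iff:
  fixes a b :: "'a::linorder"
  assumes "finite S" "a \<in> S" "b \<in> S"
  shows "card {c \<in> S. c \<le> a} < card {c \<in> S. c \<le> b} \<longleftrightarrow> a < b"
proof
  assume "a < b"
  with assms show "card {c \<in> S. c \<le> a} < card {c \<in> S. c \<le> b}"
    by (intro psubset_card_mono psubsetI) (auto simp: set_eq_iff intro!: exI[of _ b])
next
  assume *: "card {c \<in> S. c \<le> a} < card {c \<in> S. c \<le> b}"
  show "a < b"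
  proof (rule ccontr)
    assume "\<not> a < b"
    with assms(1) have "card {c \<in> S. c \<le> b} \<le> card {c \<in> S. c \<le> a}"
      by (intro card_mono) auto
    with * show False by simp
  qed
qed

section \<open>Avoidance of 132 under concatenation and shifts\<close>

lemma avoids_132_iff:
  "avoids w [1, 3, 2] \<longleftrightarrow> (\<forall>a b c. subseq [a, c, b] w \<longrightarrow> a < b \<longrightarrow> b < c \<longrightarrow> False)"
proof
  assume av: "avoids w [1, 3, 2]"
  show "\<forall>a b c. subseq [a, c, b] w \<longrightarrow> a < b \<longrightarrow> b < c \<longrightarrow> False"
  proof (intro allI impI)
    fix a b c :: nat
    assume s: "subseq [a, c, b] w" and "a < b" "b < c"
    then have "{x. (x = a \<or> x = c \<or> x = b) \<and> x \<le> a} = {a}"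
      "{x. (x = a \<or> x = c \<or> x = b) \<and> x \<le> c} = {a, b, c}"
      "{x. (x = a \<or> x = c \<or> x = b) \<and> x \<le> b} = {a, b}" by auto
    then have "red [a, c, b] = [1, 3, 2]" using \<open>a < b\<close> \<open>b < c\<close> by (simp add: red_def)
    with s av show False unfolding avoids_def by blast
  qed
next
  assume *: "\<forall>a b c. subseq [a, c, b] w \<longrightarrow> a < b \<longrightarrow> b < c \<longrightarrow> False"
  show "avoids w [1, 3, 2]"
    unfolding avoids_def
  proof (intro notI, elim exE conjE)
    fix v assume s: "subseq v w" and r: "red v = [1, 3, 2]"
    have "length v = 3" using arg_cong[OF r, of length] by simp
    then obtain a c b where v: "v = [a, c, b]"
      by (auto simp: numeral_3_eq_3 length_Suc_conv)
    have "card {x \<in> set v. x \<le> a} = 1" "card {x \<in> set v. x \<le> c} = 3"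
      "card {x \<in> set v. x \<le> b} = 2"
      using r by (simp_all add: v red_def)
    then have "a < b" "b < c"
      using card_le_less_iff[of "set v" a b] card_le_less_iff[of "set v" b c] by (auto simp: v)
    with * s v show False by blast
  qed
qed

lemma avoids_subseq: "subseq v w \<Longrightarrow> avoids w \<tau> \<Longrightarrow> avoids v \<tau>"
  unfolding avoids_def using subseq_order.order_trans by blast

text \<open>An occurrence of 132 that uses both words starts in \<open>A\<close> and ends in
  \<open>B\<close>. Its last letter would then be below its first, whereas in 132 the last letter is
  the larger one.\<close>

lemma avoids_132_append:
  assumes "\<And>a b. a \<in> set A \<Longrightarrow> b \<in> set B \<Longrightarrow> b < a"
  shows "avoids (A @ B) [1, 3, 2] \<longleftrightarrow> avoids A [1, 3, 2] \<and> avoids B [1, 3, 2]"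
proof
  assume "avoids (A @ B) [1, 3, 2]"
  then show "avoids A [1, 3, 2] \<and> avoids B [1, 3, 2]"
    using avoids_subseq[of A "A @ B"] avoids_subseq[of B "A @ B"] by auto
next
  assume *: "avoids A [1, 3, 2] \<and> avoids B [1, 3, 2]"
  show "avoids (A @ B) [1, 3, 2]"
    unfolding avoids_132_iff
  proof (intro allI impI)
    fix a b c :: nat
    assume s: "subseq [a, c, b] (A @ B)" and ab: "a < b" and bc: "b < c"
    from s obtain u v where uv: "[a, c, b] = u @ v" "subseq u A" "subseq v B"
      by (auto simp: subseq_append_iff)
    have "set u \<subseteq> set A" "set v \<subseteq> set B"
      using uv by (auto elim: list_emb_set)
    consider "u = []" | "v = []" | "a \<in> set u" "b \<in> set v"
      using uv(1) by (cases u; cases v rule: rev_cases) auto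
    then show False
    proof cases
      case 1
      with uv * ab bc show False unfolding avoids_132_iff by (metis append_Nil)
    next
      case 2
      with uv * ab bc show False unfolding avoids_132_iff by (metis append_Nil2)
    next
      case 3
      then show False using assms[of a b] \<open>set u \<subseteq> set A\<close> \<open>set v \<subseteq> set B\<close> ab by auto
    qed
  qed
qed

text \<open>An occurrence of 132 that uses the final letter \<open>n\<close> has it in the role of
  2. The letter in the role of 3 would then lie in \<open>A\<close> and exceed
  \<open>n\<close>.\<close>

lemma avoids_132_snoc:
  assumes "\<And>a. a \<in> set A \<Longrightarrow> a < n"
  shows "avoids (A @ [n]) [1, 3, 2] \<longleftrightarrow> avoids A [1, 3, 2]"
proof
  assume "avoids (A @ [n]) [1, 3, 2]"
  then show "avoids A [1, 3, 2]" using avoids_subseq[of A "A @ [n]"] by auto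
next
  assume *: "avoids A [1, 3, 2]"
  show "avoids (A @ [n]) [1, 3, 2]"
    unfolding avoids_132_iff
  proof (intro allI impI)
    fix a b c :: nat
    assume s: "subseq [a, c, b] (A @ [n])" and ab: "a < b" and bc: "b < c"
    from s obtain u v where uv: "[a, c, b] = u @ v" "subseq u A" "subseq v [n]"
      by (auto simp: subseq_append_iff)
    have "set u \<subseteq> set A" "set v \<subseteq> {n}"
      using uv by (auto elim: list_emb_set)
    have "length v \<le> 1" using uv(3) list_emb_length by fastforce
    then consider "v = []" | "c \<in> set u" "b \<in> set v"
      using uv(1) by (cases v rule: rev_cases; cases u rule: rev_cases) auto
    then show False
    proof cases
      case 1
      with uv * ab bc show False unfolding avoids_132_iff by (metis append_Nil2)
    next
      case 2
      then have "c < n" "b = n" using assms \<open>set u \<subseteq> set A\<close> \<open>set v \<subseteq> {n}\<close> by auto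
      with bc show False by simp
    qed
  qed
qed

lemma avoids_map_add: "avoids (map (\<lambda>a. a + k) w) \<tau> \<longleftrightarrow> avoids w \<tau>" for w :: "nat list"
proof -
  have red: "red (map (\<lambda>a. a + k) v) = red v" for v :: "nat list"
    by (rule red_map) (auto simp: strict_mono_on_def)
  \<comment> \<open>A subsequence is a selection of positions, and such a selection commutes with
    \<open>map\<close>.\<close>
  have sub: "subseq v (map (\<lambda>a. a + k) w) \<longleftrightarrow> (\<exists>v'. v = map (\<lambda>a. a + k) v' \<and> subseq v' w)" for v
    by (auto simp: subseq_conv_nths nths_map)
  have "(\<exists>v. subseq v (map (\<lambda>a. a + k) w) \<and> red v = \<tau>) \<longleftrightarrow>
      (\<exists>v. subseq v w \<and> red (map (\<lambda>a. a + k) v) = \<tau>)"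
    unfolding sub by auto
  then show ?thesis by (simp only: avoids_def red)
qed

section \<open>Counting matches in shifted, extended and concatenated words\<close>

lemma mch_map:
  assumes "strict_mono_on (set w) f"
  shows "mch \<gamma> (map f w) = mch \<gamma> w"
proof -
  have "red (take k (drop i (map f w))) = red (take k (drop i w))" for i k
  proof -
    have "strict_mono_on (set (take k (drop i w))) f"
      using assms by (rule monotone_on_subset) (metis in_set_takeD in_set_dropD subsetI)
    then show ?thesis by (metis red_map take_map drop_map)
  qed
  then show ?thesis by (simp add: mch_def)
qed

lemma finite_window_positions: "finite {i. i + k \<le> (l::nat) \<and> P i}"
  by (rule finite_subset[of _ "{..l}"]) auto

lemma mch_short: "length w < length \<gamma> \<Longrightarrow> mch \<gamma> w = 0"
  by (simp add: mch_def)

text \<open>A new last letter creates at most one new window, the one that ends at it; all other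
  windows lie in \<open>w\<close>.\<close>

lemma mch_snoc:
  assumes "\<gamma> \<noteq> []"
  shows "mch \<gamma> (w @ [a]) = mch \<gamma> w + (if length \<gamma> \<le> Suc (length w) \<and>
    red (drop (Suc (length w) - length \<gamma>) (w @ [a])) = \<gamma> then 1 else 0)"
proof -
  let ?m = "length \<gamma>" and ?l = "length w"
  let ?S = "{i. i + ?m \<le> ?l \<and> red (take ?m (drop i w)) = \<gamma>}"
  let ?P = "?m \<le> Suc ?l \<and> red (drop (Suc ?l - ?m) (w @ [a])) = \<gamma>"
  let ?T = "if ?P then {Suc ?l - ?m} else {}"
  have *: "i + ?m \<le> Suc ?l \<and> red (take ?m (drop i (w @ [a]))) = \<gamma> \<longleftrightarrow> i \<in> ?S \<union> ?T" for i
  proof (cases "i + ?m \<le> ?l")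
    case True
    then show ?thesis using assms by auto
  next
    case False
    then have "i + ?m \<le> Suc ?l \<longleftrightarrow> ?m \<le> Suc ?l \<and> i = Suc ?l - ?m" by auto
    moreover have "take ?m (drop (Suc ?l - ?m) (w @ [a])) = drop (Suc ?l - ?m) (w @ [a])"
      by (rule take_all) simp
    ultimately show ?thesis using False by auto
  qed
  have "{i. i + ?m \<le> Suc ?l \<and> red (take ?m (drop i (w @ [a]))) = \<gamma>} = ?S \<union> ?T"
    using * by blast
  moreover have "?S \<inter> ?T = {}" using assms by (auto simp: Suc_le_eq)
  ultimately have "mch \<gamma> (w @ [a]) = card ?S + card ?T"
    by (simp add: mch_def card_Un_disjoint finite_window_positions)
  then show ?thesis by (simp add: mch_def)
qed

text \<open>The last letter has rank \<open>m\<close>, and the ranks form a permutation of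
  \<open>{1..m}\<close>, so no letter can have a larger rank.\<close>

lemma le_last_if_red_last_max:
  assumes "red w \<in> perms m" "last (red w) = m" "w \<noteq> []" "x \<in> set w"
  shows "x \<le> last w"
proof (rule ccontr)
  assume "\<not> x \<le> last w"
  then have "card {b \<in> set w. b \<le> last w} < card {b \<in> set w. b \<le> x}"
    using assms card_le_less_iff[of "set w" "last w" x] by auto
  moreover have "card {b \<in> set w. b \<le> last w} = m"
    using assms by (simp add: red_def last_map)
  moreover have "card {b \<in> set w. b \<le> x} \<le> m"
  proof -
    have "card {b \<in> set w. b \<le> x} \<in> set (red w)" using assms(4) by (auto simp: red_def)
    with assms(1) show ?thesis by (simp add: perms_iff)
  qed
  ultimately show False by simp
qed

text \<open>A match across the border would contain \<open>last A\<close> and end in \<open>B\<close>, hence not with its maximum.\<close>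

lemma mch_append:
  assumes \<gamma>: "\<gamma> \<in> perms m" "last \<gamma> = m" "m \<ge> 1"
    and A: "A \<noteq> []" "\<And>b. b \<in> set B \<Longrightarrow> b < last A"
  shows "mch \<gamma> (A @ B) = mch \<gamma> A + mch \<gamma> B"
proof -
  have len: "length \<gamma> = m" using \<gamma> length_perms by blast
  let ?a = "length A"
  let ?S = "{i. i + m \<le> ?a \<and> red (take m (drop i A)) = \<gamma>}"
  let ?T = "{i. i + m \<le> length B \<and> red (take m (drop i B)) = \<gamma>}"
  have cross: False
    if "i < ?a" "?a < i + m" "i + m \<le> ?a + length B" "red (take m (drop i (A @ B))) = \<gamma>" for i
  proof -
    let ?w = "take m (drop i (A @ B))"
    have w: "?w = drop i A @ take (m - (?a - i)) B" using that by simp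
    have ne: "take (m - (?a - i)) B \<noteq> []" using that by auto
    then have "last ?w \<in> set (take (m - (?a - i)) B)" unfolding w by simp
    then have "last ?w \<in> set B" by (meson in_set_takeD)
    moreover have "last A \<in> set ?w" unfolding w using that(1) last_in_set[of "drop i A"] by simp
    then have "last A \<le> last ?w"
      using that(4) \<gamma> ne w by (intro le_last_if_red_last_max[of _ m]) auto
    ultimately show False using A(2) by fastforce
  qed
  have "i + m \<le> ?a + length B \<and> red (take m (drop i (A @ B))) = \<gamma> \<longleftrightarrow> i \<in> ?S \<union> (+) ?a ` ?T" for i
  proof -
    consider "i + m \<le> ?a" | "i < ?a" "?a < i + m" | "?a \<le> i" by linarith
    then show ?thesis
    proof cases
      case 1
      then show ?thesis using \<gamma>(3) by auto
    next
      case 2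
      then show ?thesis using cross by auto
    next
      case 3
      then obtain j where "i = ?a + j" using le_Suc_ex by blast
      then show ?thesis using \<gamma>(3) by auto
    qed
  qed
  then have "{i. i + m \<le> ?a + length B \<and> red (take m (drop i (A @ B))) = \<gamma>} = ?S \<union> (+) ?a ` ?T"
    by blast
  moreover have "?S \<inter> (+) ?a ` ?T = {}" using \<gamma>(3) by auto
  moreover have "card ((+) ?a ` ?T) = card ?T" by (simp add: card_image)
  ultimately show ?thesis
    by (simp add: mch_def len card_Un_disjoint finite_window_positions)
qed

section \<open>Decomposition of 132-avoiders at the maximum\<close>

text \<open>Since \<open>B\<close> lies below \<open>A\<close>, its letters form a downward closed
  subset of \<open>{1..n}\<close>, hence an initial segment. The letters of \<open>A\<close> fill
  the rest and become a permutation after subtracting \<open>length B\<close>.\<close>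

lemma perms_append_split:
  assumes "A @ B \<in> perms n" "\<And>a b. a \<in> set A \<Longrightarrow> b \<in> set B \<Longrightarrow> b < a"
  obtains P where "P \<in> perms (length A)" "A = map (\<lambda>a. a + length B) P" "B \<in> perms (length B)"
proof -
  have d: "distinct A" "distinct B" "set A \<inter> set B = {}" "set A \<union> set B = {1..n}"
    using assms(1) by (auto simp: perms_iff)
  have n: "length A + length B = n" using length_perms[OF assms(1)] by simp
  have cB: "card (set B) = length B" using d by (simp add: distinct_card)
  have low: "b \<le> length B" if "b \<in> set B" for b
  proof -
    have "{1..b} \<subseteq> set B"
    proof
      fix x assume x: "x \<in> {1..b}"
      have "b \<in> {1..n}" using that d by blast
      with x have "x \<in> set A \<union> set B" unfolding d by auto
      with assms(2)[of x b] that x show "x \<in> set B" by fastforce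
    qed
    from card_mono[OF _ this] show ?thesis using cB by simp
  qed
  have B: "set B = {1..length B}"
  proof (rule card_subset_eq)
    show "set B \<subseteq> {1..length B}" using low d(4) by fastforce
  qed (use cB in auto)
  have "set A = {1..n} - {1..length B}" using d(3,4) B by blast
  also have "\<dots> = {length B + 1..n}" by auto
  finally have A: "set A = {length B + 1..n}" .
  let ?P = "map (\<lambda>a. a - length B) A"
  have "map (\<lambda>a. a + length B) ?P = A" unfolding map_map comp_def by (rule map_idI) (simp add: A)
  moreover have "?P \<in> perms (length A)"
  proof -
    have "x \<in> (\<lambda>a. a - length B) ` {length B + 1..n}" if "x \<in> {1..length A}" for x
      using that n by (intro image_eqI[of _ _ "x + length B"]) auto
    then have "(\<lambda>a. a - length B) ` {length B + 1..n} = {1..length A}"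
      using n by auto
    moreover have "inj_on (\<lambda>a. a - length B) (set A)" using A by (auto simp: inj_on_def)
    ultimately show ?thesis using d A by (simp add: perms_iff distinct_map)
  qed
  moreover have "B \<in> perms (length B)" using B d by (simp add: perms_iff)
  ultimately show ?thesis using that[of ?P] by simp
qed

lemma perms_append:
  assumes "P \<in> perms k" "Q \<in> perms l"
  shows "map (\<lambda>a. a + l) P @ Q \<in> perms (k + l)"
proof -
  have "(\<lambda>a. a + l) ` {1..k} = {1 + l..k + l}" by (simp add: image_add_atLeastAtMost')
  then show ?thesis using assms by (auto simp: perms_iff distinct_map)
qed

lemma finite_avoiders [simp]: "finite (avoiders n \<tau>)"
  by (simp add: avoiders_def perms_def)

text \<open>If \<open>a < b\<close>, then \<open>a\<close>, \<open>n\<close>, \<open>b\<close> would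
  be an occurrence of 132 with \<open>n\<close> in the role of 3.\<close>

lemma avoids_132_max:
  assumes "avoids (A @ n # B) [1, 3, 2]" "distinct (A @ n # B)"
    and "\<And>b. b \<in> set B \<Longrightarrow> b < n" "a \<in> set A" "b \<in> set B"
  shows "b < a"
proof (rule ccontr)
  assume "\<not> b < a"
  moreover have "a \<noteq> b" using assms by auto
  moreover have "subseq ([a] @ [n, b]) (A @ n # B)"
    using assms(4,5) by (intro list_emb_append_mono) (simp_all add: subseq_singleton_left)
  ultimately show False
    using assms(1,3,5) unfolding avoids_132_iff by (metis append_Cons append_Nil linorder_neqE_nat)
qed

text \<open>Here \<open>i\<close> is the number of letters before the maximum. Avoidance forces them
  to take the \<open>i\<close> largest of the remaining values, which explains the shift by
  \<open>n - i\<close>; conversely, neither the maximum nor the border of the two blocks creates an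
  occurrence of 132.\<close>

lemma avoiders_132_Suc_bij:
  "bij_betw (\<lambda>(i, L, R). map (\<lambda>a. a + (n - i)) L @ Suc n # R)
     (SIGMA i:{..n}. avoiders i [1, 3, 2] \<times> avoiders (n - i) [1, 3, 2])
     (avoiders (Suc n) [1, 3, 2])"
  (is "bij_betw ?f ?D ?E")
  unfolding bij_betw_def
proof (intro conjI equalityI subsetI)
  show "inj_on ?f ?D"
  proof (rule inj_onI)
    fix p q assume p: "p \<in> ?D" and q: "q \<in> ?D" and eq: "?f p = ?f q"
    obtain i L R where pe: "p = (i, L, R)" by (cases p) auto
    obtain j K S where qe: "q = (j, K, S)" by (cases q) auto
    have i: "i \<le> n" "set L = {1..i}" "set R = {1..n - i}" "length L = i"
      using p by (auto simp: pe avoiders_def perms_iff length_perms)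
    have j: "j \<le> n" "set K = {1..j}" "set S = {1..n - j}" "length K = j"
      using q by (auto simp: qe avoiders_def perms_iff length_perms)
    have "map (\<lambda>a. a + (n - i)) L @ Suc n # R = map (\<lambda>a. a + (n - j)) K @ Suc n # S"
      using eq by (simp add: pe qe)
    \<comment> \<open>The maximum occurs only once, so its position separates the two parts
      uniquely.\<close>
    moreover have "Suc n \<notin> set (map (\<lambda>a. a + (n - i)) L)" "Suc n \<notin> set R"
      using i by auto
    ultimately have *: "map (\<lambda>a. a + (n - i)) L = map (\<lambda>a. a + (n - j)) K" "R = S"
      by (simp_all add: append_Cons_eq_iff)
    then have "length L = length K" by (metis length_map)
    then have "i = j" using i(4) j(4) by simp
    moreover have "inj (\<lambda>a::nat. a + (n - j))" by (simp add: inj_on_def)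
    ultimately show "p = q" using * by (simp add: pe qe)
  qed
next
  fix \<sigma> assume "\<sigma> \<in> ?f ` ?D"
  then obtain i L R where i: "i \<le> n" and L: "L \<in> perms i" "avoids L [1, 3, 2]"
    and R: "R \<in> perms (n - i)" "avoids R [1, 3, 2]"
    and \<sigma>: "\<sigma> = map (\<lambda>a. a + (n - i)) L @ Suc n # R"
    by (auto simp: avoiders_def)
  \<comment> \<open>The shift by \<open>n - i\<close> turns \<open>Suc i\<close> into
    \<open>Suc n\<close>. The maximum thus joins the left part, and \<sigma> is a high block
    followed by the low block \<open>R\<close>.\<close>
  have "L @ [Suc i] \<in> perms (Suc i)" using L by (auto simp: perms_iff)
  from perms_append[OF this R(1)] have "\<sigma> \<in> perms (Suc n)" using i by (simp add: \<sigma>)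
  moreover have "avoids (map (\<lambda>a. a + (n - i)) (L @ [Suc i]) @ R) [1, 3, 2]"
  proof (subst avoids_132_append)
    show "avoids (map (\<lambda>a. a + (n - i)) (L @ [Suc i])) [1, 3, 2] \<and> avoids R [1, 3, 2]"
      unfolding avoids_map_add using L R
      by (subst avoids_132_snoc) (auto simp: perms_iff)
  qed (use L R in \<open>auto simp: perms_iff\<close>)
  ultimately show "\<sigma> \<in> ?E" using i by (simp add: avoiders_def \<sigma>)
next
  fix \<sigma> assume "\<sigma> \<in> ?E"
  then have p: "\<sigma> \<in> perms (Suc n)" and av: "avoids \<sigma> [1, 3, 2]" by (auto simp: avoiders_def)
  have "Suc n \<in> set \<sigma>" using p by (simp add: perms_iff)
  then obtain A R where \<sigma>: "\<sigma> = A @ Suc n # R" by (auto dest: split_list)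
  have d: "distinct (A @ Suc n # R)" and s: "set A \<union> insert (Suc n) (set R) = {1..Suc n}"
    using p by (auto simp: perms_iff \<sigma>)
  have "x < Suc n" if "x \<in> set A \<union> set R" for x
  proof -
    have "x \<in> {1..Suc n}" using s that by blast
    moreover have "x \<noteq> Suc n" using d that by auto
    ultimately show ?thesis by simp
  qed
  then have lt: "b < Suc n" if "b \<in> set R" for b using that by blast
  \<comment> \<open>Deleting the maximum leaves a high block and a low block, to which
    \<open>perms_append_split\<close> applies.\<close>
  have "A @ R \<in> perms n"
  proof -
    have "set (A @ R) = {1..Suc n} - {Suc n}" using s d by auto
    also have "\<dots> = {1..n}" by auto
    finally show ?thesis using d by (simp add: perms_iff)
  qed
  then obtain L where L: "L \<in> perms (length A)" "A = map (\<lambda>a. a + length R) L"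
    and R: "R \<in> perms (length R)"
    using avoids_132_max[OF av[unfolded \<sigma>] d lt] by (rule perms_append_split) auto
  have len: "length A + length R = n" using length_perms[OF \<open>A @ R \<in> perms n\<close>] by simp
  have "avoids A [1, 3, 2]" "avoids R [1, 3, 2]"
    using av avoids_subseq[of A \<sigma>] avoids_subseq[of R \<sigma>]
    by (auto simp: \<sigma> subseq_drop_many)
  then have "avoids L [1, 3, 2]" using L(2) avoids_map_add by metis
  moreover have "n - length A = length R" using len by simp
  ultimately have "(length A, L, R) \<in> ?D"
    using L R \<open>avoids R [1, 3, 2]\<close> len by (simp add: avoiders_def)
  moreover have "\<sigma> = ?f (length A, L, R)"
    using L(2) \<open>n - length A = length R\<close> by (simp add: \<sigma>)
  ultimately show "\<sigma> \<in> ?f ` ?D" by blast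
qed

text \<open>The left block including the maximum ends with a letter above all of \<open>R\<close>,
  so \<open>mch_append\<close> applies, and the shift does not affect matches.\<close>

lemma mch_decomposition:
  assumes "\<gamma> \<in> perms m" "last \<gamma> = m" "m \<ge> 1" and "i \<le> n" "R \<in> perms (n - i)"
  shows "mch \<gamma> (map (\<lambda>a. a + (n - i)) L @ Suc n # R) = mch \<gamma> (L @ [Suc i]) + mch \<gamma> R"
proof -
  have "map (\<lambda>a. a + (n - i)) L @ Suc n # R = map (\<lambda>a. a + (n - i)) (L @ [Suc i]) @ R"
    using assms(4) by simp
  also have "mch \<gamma> \<dots> = mch \<gamma> (map (\<lambda>a. a + (n - i)) (L @ [Suc i])) + mch \<gamma> R"
    using assms(4,5) by (intro mch_append[OF assms(1-3)]) (auto simp: perms_iff)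
  also have "mch \<gamma> (map (\<lambda>a. a + (n - i)) (L @ [Suc i])) = mch \<gamma> (L @ [Suc i])"
    by (rule mch_map) (auto simp: strict_mono_on_def)
  finally show ?thesis .
qed

section \<open>Matches that end at the maximum, for \<gamma> of length \<open>k + 2\<close>\<close>

lemma pattern_perms:
  assumes "D \<in> perms k"
  shows "Suc k # D @ [Suc (Suc k)] \<in> perms (Suc (Suc k))"
  using assms by (auto simp: perms_iff)

text \<open>As \<open>D\<close> consists of exactly the letters \<open>1\<close> to
  \<open>k\<close>, raising the two largest letters of \<gamma> to \<open>a < c\<close> is a
  strictly increasing relabelling.\<close>

lemma red_pattern:
  assumes "D \<in> perms k" "k < a" "a < c"
  shows "red (a # D @ [c]) = Suc k # D @ [Suc (Suc k)]"
proof -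
  let ?\<gamma> = "Suc k # D @ [Suc (Suc k)]"
  define f where "f x = (if x \<le> k then x else if x = Suc k then a else c)" for x
  have "map f D = D" using assms(1) by (intro map_idI) (simp add: f_def perms_iff)
  then have "a # D @ [c] = map f ?\<gamma>" by (simp add: f_def)
  moreover have "strict_mono_on (set ?\<gamma>) f"
    using assms by (auto simp: strict_mono_on_def f_def perms_iff)
  ultimately show ?thesis
    using red_map[of ?\<gamma> f] red_perm[OF pattern_perms[OF assms(1)]] by simp
qed

text \<open>A match of \<open>\<gamma>\<close> ends at the last letter of \<open>L @ [n]\<close>.\<close>

definition pattern_ends :: "nat \<Rightarrow> nat list \<Rightarrow> nat list \<Rightarrow> bool" where
  "pattern_ends n \<gamma> L \<longleftrightarrow> length \<gamma> \<le> Suc (length L) \<and>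
     red (drop (Suc (length L) - length \<gamma>) (L @ [n])) = \<gamma>"

text \<open>Inserting \<open>D\<close> below \<open>P\<close> makes the last letter of
  \<open>P\<close>, the word \<open>D\<close> and \<open>Suc i\<close> a match. Within
  \<open>L\<close> no match is gained: none crosses the border by \<open>mch_append\<close>, and
  \<open>D\<close> is too short to contain one.\<close>

lemma pattern_ends_append:
  assumes "D \<in> avoiders k [1, 3, 2]" "k < i" "P \<in> avoiders (i - k) [1, 3, 2]"
  defines "\<gamma> \<equiv> Suc k # D @ [Suc (Suc k)]"
  defines "L \<equiv> map (\<lambda>a. a + k) P @ D"
  shows "L \<in> avoiders i [1, 3, 2]" "pattern_ends (Suc i) \<gamma> L" "mch \<gamma> L = mch \<gamma> P"
proof -
  have D: "D \<in> perms k" "avoids D [1, 3, 2]" and P: "P \<in> perms (i - k)" "avoids P [1, 3, 2]"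
    using assms by (auto simp: avoiders_def)
  have len: "length D = k" "length P = i - k" using D P by (simp_all add: length_perms)
  \<comment> \<open>\<open>k < i\<close> makes \<open>P\<close> nonempty; its last letter
    \<open>a\<close>, shifted by \<open>k\<close>, starts the match.\<close>
  then obtain P' a where P': "P = P' @ [a]" using assms(2) by (cases P rule: rev_cases) auto
  have a: "1 \<le> a" "a \<le> i - k" using P by (auto simp: P' perms_iff)
  have less: "b < c" if "b \<in> set D" "c \<in> set (map (\<lambda>a. a + k) P)" for b c
    using that D P by (auto simp: perms_iff)
  have "L \<in> perms i" using perms_append[OF P(1) D(1)] assms(2) by (simp add: L_def)
  moreover have "avoids L [1, 3, 2]"
    unfolding L_def using less D(2) P(2)
    by (subst avoids_132_append) (auto simp only: avoids_map_add)
  ultimately show "L \<in> avoiders i [1, 3, 2]" by (simp add: avoiders_def)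
  have "drop (Suc (length L) - length \<gamma>) (L @ [Suc i]) = (a + k) # D @ [Suc i]"
    using len by (simp add: L_def \<gamma>_def P')
  moreover have "red ((a + k) # D @ [Suc i]) = \<gamma>"
    unfolding \<gamma>_def using a assms(2) by (intro red_pattern[OF D(1)]) auto
  moreover have "length \<gamma> \<le> Suc (length L)" using len assms(2) by (simp add: L_def \<gamma>_def)
  ultimately show "pattern_ends (Suc i) \<gamma> L" by (simp add: pattern_ends_def)
  have "mch \<gamma> L = mch \<gamma> (map (\<lambda>a. a + k) P) + mch \<gamma> D"
    unfolding L_def
  proof (rule mch_append)
    show "\<gamma> \<in> perms (Suc (Suc k))" using pattern_perms[OF D(1)] by (simp add: \<gamma>_def)
    show "map (\<lambda>a. a + k) P \<noteq> []" by (simp add: P')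
    show "b < last (map (\<lambda>a. a + k) P)" if "b \<in> set D" for b
      using less[OF that] by (simp add: P')
  qed (simp_all add: \<gamma>_def)
  moreover have "mch \<gamma> (map (\<lambda>a. a + k) P) = mch \<gamma> P"
    by (rule mch_map) (auto simp: strict_mono_on_def)
  moreover have "mch \<gamma> D = 0" by (rule mch_short) (simp add: \<gamma>_def)
  ultimately show "mch \<gamma> L = mch \<gamma> P" by simp
qed

text \<open>The converse of \<open>pattern_ends_append\<close>: a match at the end forces
  \<open>L\<close> to end with \<open>D\<close> itself, not merely with a word of the same relative
  order, because avoidance makes these letters the \<open>k\<close> smallest.\<close>

lemma pattern_ends_split:
  assumes D: "D \<in> avoiders k [1, 3, 2]" and L: "L \<in> avoiders i [1, 3, 2]"
    and ends: "pattern_ends (Suc i) (Suc k # D @ [Suc (Suc k)]) L"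
  obtains P where "k < i" "P \<in> avoiders (i - k) [1, 3, 2]" "L = map (\<lambda>a. a + k) P @ D"
proof -
  have D': "D \<in> perms k" and L': "L \<in> perms i" "avoids L [1, 3, 2]"
    using D L by (auto simp: avoiders_def)
  have len: "length D = k" "length L = i" using D' L' by (simp_all add: length_perms)
  have ki: "k < i" using ends len by (simp add: pattern_ends_def)
  \<comment> \<open>The final window has \<open>k + 2\<close> letters: the last \<open>Suc k\<close>
    letters of \<open>L\<close>, called \<open>a # d\<close>, and then \<open>Suc i\<close>.
    \<open>U\<close> is what precedes it.\<close>
  define U where "U = take (i - Suc k) L"
  have "length (drop (i - Suc k) L) = Suc k" using ki len by simp
  then obtain a d where ad: "drop (i - Suc k) L = a # d" by (cases "drop (i - Suc k) L") auto
  have lend: "length d = k" using ad \<open>length (drop (i - Suc k) L) = Suc k\<close> by simp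
  have LU: "L = U @ a # d" unfolding U_def using ad by (metis append_take_drop_id)
  have lenU: "length U = i - Suc k" using LU len lend by simp
  let ?S = "set (a # d @ [Suc i])"
  let ?r = "\<lambda>x. card {b \<in> ?S. b \<le> x}"
  have "red (a # d @ [Suc i]) = Suc k # D @ [Suc (Suc k)]"
    using ends ad len ki by (simp add: pattern_ends_def)
  then have ra: "?r a = Suc k" and rd: "map ?r d = D"
    using lend len by (simp_all add: red_def)
  have less_a: "x < a" if "x \<in> set d" for x
  proof -
    have "?r x \<in> set (map ?r d)" using that unfolding set_map by (rule imageI)
    then have "?r x \<in> {1..k}" using D' unfolding rd perms_iff by blast
    then have "?r x < ?r a" unfolding ra by simp
    then show "x < a" using that by (subst (asm) card_le_less_iff) auto
  qed
  have dist: "distinct (U @ a # d)" and av: "avoids (U @ a # d) [1, 3, 2]"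
    using L' by (auto simp: perms_iff LU)
  \<comment> \<open>For \<open>u\<close> in \<open>U\<close>, \<open>avoids_132_max\<close> is used
    with \<open>a\<close> in place of the maximum: \<open>u < x\<close> would make \<open>u\<close>,
    \<open>a\<close>, \<open>x\<close> an occurrence of 132.\<close>
  have "x < u" if "u \<in> set (U @ [a])" "x \<in> set d" for u x
    using that less_a avoids_132_max[OF av dist less_a] by auto
  moreover have "(U @ [a]) @ d \<in> perms i" using L' LU by simp
  ultimately obtain P where P: "P \<in> perms (length (U @ [a]))" "U @ [a] = map (\<lambda>a. a + k) P"
    and dp: "d \<in> perms k"
    using lend by (elim perms_append_split) auto
  \<comment> \<open>Both \<open>a\<close> and \<open>Suc i\<close> exceed \<open>x\<close>, so the
    rank of \<open>x\<close> in the window is its rank in \<open>d\<close>, a permutation of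
    \<open>{1..k}\<close>. Hence \<open>d\<close> equals its list of ranks, which is
    \<open>D\<close>.\<close>
  have "?r x = x" if x: "x \<in> set d" for x
  proof -
    have "x \<in> {1..i}" using L'(1) x LU by (auto simp: perms_iff)
    then have "{b \<in> ?S. b \<le> x} = {b \<in> set d. b \<le> x}" using less_a[OF x] by auto
    also have "\<dots> = {1..x}" using dp x by (auto simp: perms_iff)
    finally show ?thesis by simp
  qed
  then have "map ?r d = d" by (intro map_idI)
  then have "d = D" using rd by simp
  then have LP: "L = map (\<lambda>a. a + k) P @ D" using LU P(2) by simp
  have "avoids (map (\<lambda>a. a + k) P) [1, 3, 2]"
    using _ L'(2) by (rule avoids_subseq) (auto simp: LP)
  moreover have "length (U @ [a]) = i - k" using lenU ki by simp
  ultimately have "P \<in> avoiders (i - k) [1, 3, 2]"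
    using P(1) unfolding avoids_map_add by (simp only: avoiders_def mem_Collect_eq)
  from ki this LP show ?thesis by (rule that)
qed

text \<open>If a match ends at the appended maximum, the weight is
  \<open>x ^ Suc e = x ^ e + (x - 1) * x ^ e\<close> with \<open>e = mch \<gamma> L\<close>. The
  correction is summed over the words \<open>L\<close> obtained from some \<open>P\<close> by
  appending \<open>D\<close>, and such an \<open>L\<close> has as many matches as
  \<open>P\<close>.\<close>

lemma sum_mch_snoc:
  fixes x :: "'a::comm_ring_1"
  assumes D: "D \<in> avoiders k [1, 3, 2]"
  defines "\<gamma> \<equiv> Suc k # D @ [Suc (Suc k)]"
  shows "(\<Sum>L \<in> avoiders i [1, 3, 2]. x ^ mch \<gamma> (L @ [Suc i])) =
    (\<Sum>L \<in> avoiders i [1, 3, 2]. x ^ mch \<gamma> L) +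
    (x - 1) * (if k < i then \<Sum>P \<in> avoiders (i - k) [1, 3, 2]. x ^ mch \<gamma> P else 0)"
proof -
  let ?A = "avoiders i [1, 3, 2]"
  let ?E = "{L \<in> ?A. pattern_ends (Suc i) \<gamma> L}"
  have "x ^ mch \<gamma> (L @ [Suc i]) =
      x ^ mch \<gamma> L + (if pattern_ends (Suc i) \<gamma> L then (x - 1) * x ^ mch \<gamma> L else 0)" for L
    by (subst mch_snoc) (auto simp: \<gamma>_def pattern_ends_def algebra_simps)
  then have "(\<Sum>L \<in> ?A. x ^ mch \<gamma> (L @ [Suc i])) =
      (\<Sum>L \<in> ?A. x ^ mch \<gamma> L) + (\<Sum>L \<in> ?E. (x - 1) * x ^ mch \<gamma> L)"
    by (simp only: sum.distrib sum.inter_filter[OF finite_avoiders] sum_distrib_left)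
  also have "\<dots> = (\<Sum>L \<in> ?A. x ^ mch \<gamma> L) + (x - 1) * (\<Sum>L \<in> ?E. x ^ mch \<gamma> L)"
    by (simp only: sum_distrib_left)
  also have "(\<Sum>L \<in> ?E. x ^ mch \<gamma> L) =
      (if k < i then \<Sum>P \<in> avoiders (i - k) [1, 3, 2]. x ^ mch \<gamma> P else 0)"
  proof (cases "k < i")
    case True
    let ?f = "\<lambda>P. map (\<lambda>a. a + k) P @ D"
    have "inj_on ?f (avoiders (i - k) [1, 3, 2])"
    proof (rule inj_onI)
      fix P Q assume "?f P = ?f Q"
      moreover have "inj (\<lambda>a::nat. a + k)" by (simp add: inj_on_def)
      ultimately show "P = Q" by simp
    qed
    moreover have "?E = ?f ` avoiders (i - k) [1, 3, 2]"
    proof (intro equalityI subsetI)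
      fix L assume "L \<in> ?E"
      then show "L \<in> ?f ` avoiders (i - k) [1, 3, 2]"
        using pattern_ends_split[OF D, of L i] unfolding \<gamma>_def by blast
    next
      fix L assume "L \<in> ?f ` avoiders (i - k) [1, 3, 2]"
      then show "L \<in> ?E" using pattern_ends_append[OF D True] unfolding \<gamma>_def by blast
    qed
    ultimately have "(\<Sum>L \<in> ?E. x ^ mch \<gamma> L) =
        (\<Sum>P \<in> avoiders (i - k) [1, 3, 2]. x ^ mch \<gamma> (?f P))"
      by (simp add: sum.reindex)
    also have "\<dots> = (\<Sum>P \<in> avoiders (i - k) [1, 3, 2]. x ^ mch \<gamma> P)"
      using pattern_ends_append(3)[OF D True] by (intro sum.cong refl) (simp add: \<gamma>_def)
    finally show ?thesis using True by simp
  next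
    case False
    then have "?E = {}" using pattern_ends_split[OF D, of _ i] unfolding \<gamma>_def by blast
    then show ?thesis using False by (simp only: sum.empty if_False)
  qed
  finally show ?thesis .
qed

section \<open>The functional equation of the generating function\<close>

lemma avoiders_0: "avoiders 0 [1, 3, 2] = {[]}"
proof -
  have "avoids [] [1, 3, 2]" by (simp only: avoids_132_iff) simp
  then show ?thesis by (auto simp: avoiders_def perms_def)
qed

text \<open>The series \<open>?V\<close> counts the left parts \<open>L\<close>, weighted by the
  matches in \<open>L\<close> followed by the maximum. Its product with \<open>B\<close> accounts
  for the pairs of left and right parts, and \<open>fps_X\<close> for the maximum itself.\<close>

lemma gf132_pattern:
  fixes k :: nat
  assumes D: "D \<in> avoiders k [1, 3, 2]"
  defines "\<gamma> \<equiv> Suc k # D @ [Suc (Suc k)]"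
  defines "B \<equiv> gf132 \<gamma>"
  shows "B = 1 + fps_X * ((B + fps_X ^ k * fps_const ([:0, 1:] - 1) * (B - 1)) * B)"
    (is "B = 1 + fps_X * (?V * B)")
proof -
  let ?x = "[:0, 1:] :: rat poly"
  have D': "D \<in> perms k" using D by (simp add: avoiders_def)
  have \<gamma>: "\<gamma> \<in> perms (Suc (Suc k))" "last \<gamma> = Suc (Suc k)"
    using pattern_perms[OF D'] by (simp_all add: \<gamma>_def)
  have B: "fps_nth B n = (\<Sum>\<sigma> \<in> avoiders n [1, 3, 2]. ?x ^ mch \<gamma> \<sigma>)" for n
    by (simp add: B_def gf132_def)
  have B0: "fps_nth B 0 = 1"
    unfolding B avoiders_0 by (simp add: mch_short \<gamma>_def)
  have "fps_nth ?V i = fps_nth B i + (?x - 1) * (if k < i then fps_nth B (i - k) else 0)" for i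
  proof -
    have "fps_X ^ k * fps_const (?x - 1) * (B - 1) = fps_const (?x - 1) * (fps_X ^ k * (B - 1))"
      by (simp only: ac_simps)
    then have "fps_nth ?V i = fps_nth B i + (?x - 1) * fps_nth (fps_X ^ k * (B - 1)) i"
      by (simp only: fps_add_nth fps_mult_left_const_nth)
    \<comment> \<open>Since \<open>B\<close> has constant coefficient 1, the coefficient at
      \<open>i = k\<close> vanishes. Passing from \<open>B\<close> to \<open>B - 1\<close> thus
      excludes the empty \<open>P\<close>, in accordance with the strict
      \<open>k < i\<close>.\<close>
    moreover have "fps_nth (fps_X ^ k * (B - 1)) i = (if k < i then fps_nth B (i - k) else 0)"
      using B0 by (cases "i = k") (auto simp: fps_X_power_mult_nth)
    ultimately show ?thesis by simp
  qed
  then have V: "fps_nth ?V i = (\<Sum>L \<in> avoiders i [1, 3, 2]. ?x ^ mch \<gamma> (L @ [Suc i]))" for i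
    using sum_mch_snoc[OF D, of ?x i] by (simp add: B \<gamma>_def)
  show ?thesis
  proof (rule fps_ext)
    fix n show "fps_nth B n = fps_nth (1 + fps_X * (?V * B)) n"
    proof (cases n)
      case 0
      then show ?thesis using B0 by simp
    next
      case (Suc n)
      let ?S = "SIGMA i:{..n}. avoiders i [1, 3, 2] \<times> avoiders (n - i) [1, 3, 2]"
      have "fps_nth B (Suc n) =
          (\<Sum>(i, L, R) \<in> ?S. ?x ^ mch \<gamma> (map (\<lambda>a. a + (n - i)) L @ Suc n # R))"
        unfolding B using sum.reindex_bij_betw[OF avoiders_132_Suc_bij[of n],
          of "\<lambda>\<sigma>. ?x ^ mch \<gamma> \<sigma>"] by (simp add: case_prod_unfold)
      also have "\<dots> = (\<Sum>(i, L, R) \<in> ?S. ?x ^ mch \<gamma> (L @ [Suc i]) * ?x ^ mch \<gamma> R)"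
      proof (rule sum.cong[OF refl])
        fix p assume "p \<in> ?S"
        then obtain i L R where p: "p = (i, L, R)" and "i \<le> n" "R \<in> avoiders (n - i) [1, 3, 2]"
          by (elim SigmaE) simp
        then have "mch \<gamma> (map (\<lambda>a. a + (n - i)) L @ Suc n # R) = mch \<gamma> (L @ [Suc i]) + mch \<gamma> R"
          by (intro mch_decomposition[OF \<gamma>]) (simp_all add: avoiders_def)
        then show "(case p of (i, L, R) \<Rightarrow> ?x ^ mch \<gamma> (map (\<lambda>a. a + (n - i)) L @ Suc n # R)) =
            (case p of (i, L, R) \<Rightarrow> ?x ^ mch \<gamma> (L @ [Suc i]) * ?x ^ mch \<gamma> R)"
          by (simp only: p prod.case power_add)
      qed
      also have "\<dots> = (\<Sum>i\<le>n. \<Sum>(L, R) \<in> avoiders i [1, 3, 2] \<times> avoiders (n - i) [1, 3, 2].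
          ?x ^ mch \<gamma> (L @ [Suc i]) * ?x ^ mch \<gamma> R)"
        by (rule sum.Sigma[symmetric]) auto
      also have "\<dots> = (\<Sum>i\<le>n. fps_nth ?V i * fps_nth B (n - i))"
        unfolding V B by (simp only: sum_product sum.cartesian_product)
      also have "\<dots> = fps_nth (?V * B) n" by (simp only: fps_mult_nth atMost_atLeast0)
      also have "\<dots> = fps_nth (1 + fps_X * (?V * B)) (Suc n)"
        by (simp only: fps_add_nth fps_X_mult_nth) simp
      finally show ?thesis using Suc by simp
    qed
  qed
qed

text \<open>With \<open>m - 1\<close> and \<open>m\<close> taken by the two ends, the letters in
  between are \<open>1\<close> to \<open>k = m - 2\<close>, and as a subsequence of \<gamma> they
  still avoid 132.\<close>

lemma pattern_decomposition:
  assumes "m \<ge> 2" "\<gamma> \<in> avoiders m [1, 3, 2]" "hd \<gamma> = m - 1" "last \<gamma> = m"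
  obtains k D where "m = Suc (Suc k)" "D \<in> avoiders k [1, 3, 2]" "\<gamma> = Suc k # D @ [Suc (Suc k)]"
proof -
  obtain k where m: "m = Suc (Suc k)" using assms(1) by (metis add_2_eq_Suc le_Suc_ex)
  have p: "\<gamma> \<in> perms m" "avoids \<gamma> [1, 3, 2]" using assms(2) by (auto simp: avoiders_def)
  have "length \<gamma> = Suc (Suc k)" using p m by (simp add: length_perms)
  then obtain a u where au: "\<gamma> = a # u" "u \<noteq> []" 
    by (cases \<gamma>) fastforce+
  then obtain D c where "u = D @ [c]" by (metis rev_exhaust)
  with au have \<gamma>: "\<gamma> = Suc k # D @ [Suc (Suc k)]" using assms m by simp
  have d: "distinct (Suc k # D @ [Suc (Suc k)])"
    and s: "set (Suc k # D @ [Suc (Suc k)]) = {1..Suc (Suc k)}"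
    using p by (simp_all only: perms_iff \<gamma> m)
  have "set D = set (Suc k # D @ [Suc (Suc k)]) - {Suc k, Suc (Suc k)}" using d by auto
  also have "\<dots> = {1..k}" unfolding s by auto
  finally have "D \<in> perms k" using d by (simp add: perms_iff)
  moreover have "avoids D [1, 3, 2]"
    using _ p(2) by (rule avoids_subseq) (auto simp: \<gamma> intro: list_emb_Cons)
  ultimately show ?thesis using that m \<gamma> by (simp add: avoiders_def)
qed

theorem theorem14:
  fixes m :: nat and \<gamma> :: "nat list" and B :: "rat poly fps"
  assumes "m \<ge> 2"
    and "\<gamma> \<in> avoiders m [1, 3, 2]"
    and "hd \<gamma> = m - 1"
    and "last \<gamma> = m"
    and "B = gf132 \<gamma>"
  shows "B = fps_quot (1 + fps_X ^ (m - 1) * fps_const ([:0, 1:] - 1) * (B ^ 2 - B)) (1 - fps_X * B)"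
proof -
  obtain k D where m: "m = Suc (Suc k)" and D: "D \<in> avoiders k [1, 3, 2]"
    and \<gamma>: "\<gamma> = Suc k # D @ [Suc (Suc k)]"
    using pattern_decomposition assms by metis
  define c where "c = fps_const ([:0, 1:] - 1 :: rat poly)"
  have "B = 1 + fps_X * ((B + fps_X ^ k * c * (B - 1)) * B)"
    using gf132_pattern[OF D] unfolding assms(5) \<gamma> c_def .
  \<comment> \<open>Moving \<open>fps_X * B * B\<close> to the other side leaves the numerator, as
    \<open>Suc k = m - 1\<close> and \<open>(B - 1) * B = B ^ 2 - B\<close>.\<close>
  moreover have "1 + fps_X * ((B + fps_X ^ k * c * (B - 1)) * B) - fps_X * B * B =
      1 + fps_X ^ (m - 1) * c * (B ^ 2 - B)"
    by (simp add: m algebra_simps power2_eq_square)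
  ultimately have "B - fps_X * B * B = 1 + fps_X ^ (m - 1) * c * (B ^ 2 - B)" by simp
  then have "B * (1 - fps_X * B) = 1 + fps_X ^ (m - 1) * c * (B ^ 2 - B)"
    by (simp add: algebra_simps)
  \<comment> \<open>The denominator has constant coefficient 1, so the quotient is characterised by
    the product just computed.\<close>
  then show ?thesis unfolding c_def by (intro iffD2[OF fps_quot_unique]) simp_all
qed

end
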